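(* Let $E$ be an evolution algebra over $\mathbb{R}$ with finite set of generators $\{e_i \mid i\in\Lambda\}$ and products $e_i^2=\sum_{k\in\Lambda}a_{ik}e_k$ for $i\in\Lambda$, and $e_i\cdot e_j=0$ for $i\neq j$, where $0\le a_{ik}\le 1$ for all $i,k\in\Lambda$ and $\sum_{k\in\Lambda}a_{ik}=1$ for all $i\in\Lambda$. Then the structure obtained by taking the set of generators $\{e_i\mid i\in\Lambda\}$ as set of states and the structure constants $a_{ik}$ as transition probabilities (from $e_i$ to $e_k$) is a Markov chain; that is, there is a discrete time homogeneous Markov chain with state space $\{e_i\mid i\in\Lambda\}$ and transition probability matrix $(a_{ik})_{i,k\in\Lambda}$.
   Context: An evolution algebra over a field $K$ with set of generators $\{e_i\mid i\in\Lambda\}$ ($\Lambda$ finite and nonempty) is the $K$-algebra with vector space basis $\{e_i\mid i\in\Lambda\}$ and multiplication determined by $e_i\cdot e_j=0$ for $i\ne j$ and $e_i^2=\sum_k a_{ik}e_k$; the $a_{ik}\in K$ are the structure constants. A discrete time Markov chain is a stochastic process $\{X_n : n=0,1,\ldots\}$ with values in a countable state set $S=\{s_i : i\in\Lambda\}$ such that $\Pr[X_n=s_n\mid X_0=s_0,\ldots,X_{n-1}=s_{n-1}]=\Pr[X_n=s_n\mid X_{n-1}=s_{n-1}]$ for all $n\ge 1$. It is homogeneous if the transition probabilities $\Pr[X_{n+1}=s_j\mid X_n=s_i]$ do not depend on $n$; they are then denoted $p_{ij}=\Pr[X_1=s_j\mid X_0=s_i]$, and $(p_{ij})$ is the transition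 probability matrix. *)

theory Defs
  imports "HOL-Probability.Probability"
begin

text \<open>The underlying vector space is the whole type \<open>'v\<close>, with an arbitrary scalar multiplication.
  The product is only required to be bilinear; in particular neither associativity nor a unit is
  assumed.\<close>

locale evolution_algebra = vector_space scale
  for scale :: "'k::field \<Rightarrow> 'v::ab_group_add \<Rightarrow> 'v" +
  fixes mult :: "'v \<Rightarrow> 'v \<Rightarrow> 'v"
    and \<Lambda> :: "'i set"
    and e :: "'i \<Rightarrow> 'v"
    and a :: "'i \<Rightarrow> 'i \<Rightarrow> 'k"
  assumes linear_mult_right: "Vector_Spaces.linear scale scale (\<lambda>y. mult x y)"
    and linear_mult_left: "Vector_Spaces.linear scale scale (\<lambda>x. mult x y)"
    and finite_index: "finite \<Lambda>"
    and nonempty_index: "\<Lambda> \<noteq> {}"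
    and inj_generators: "inj_on e \<Lambda>"
    and independent_generators: "independent (e ` \<Lambda>)"
    and span_generators: "span (e ` \<Lambda>) = UNIV"
    and mult_distinct: "\<lbrakk>i \<in> \<Lambda>; j \<in> \<Lambda>; i \<noteq> j\<rbrakk> \<Longrightarrow> mult (e i) (e j) = 0"
    and mult_square: "i \<in> \<Lambda> \<Longrightarrow> mult (e i) (e i) = (\<Sum>k\<in>\<Lambda>. scale (a i k) (e k))"

text \<open>Measurability into \<^term>\<open>count_space S\<close> says both that each \<open>X n\<close> takes its values
  in \<open>S\<close> and that it is a random variable. As \<^const>\<open>cond_prob\<close> is \<open>0\<close> when the
  conditioning event is null, the Markov property and homogeneity are only required where the
  conditioning events have positive probability. The hypothesis of the Markov property makes the
  condition \<open>X (n - 1) = s (n - 1)\<close> non-null as well.\<close>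

locale discrete_markov_chain = prob_space M
  for M :: "'w measure" +
  fixes S :: "'s set"
    and X :: "nat \<Rightarrow> 'w \<Rightarrow> 's"
  assumes countable_states: "countable S"
    and random_variable_states: "X n \<in> measurable M (count_space S)"
    and markov_property:
      "\<lbrakk>n \<ge> 1; \<And>k. k \<le> n \<Longrightarrow> s k \<in> S; \<P>(\<omega> in M. \<forall>k<n. X k \<omega> = s k) > 0\<rbrakk> \<Longrightarrow>
        \<P>(\<omega> in M. X n \<omega> = s n \<bar> \<forall>k<n. X k \<omega> = s k) =
        \<P>(\<omega> in M. X n \<omega> = s n \<bar> X (n - 1) \<omega> = s (n - 1))"

locale homogeneous_markov_chain = discrete_markov_chain +
  assumes homogeneous:
    "\<lbrakk>s \<in> S; t \<in> S; \<P>(\<omega> in M. X m \<omega> = s) > 0; \<P>(\<omega> in M. X n \<omega> = s) > 0\<rbrakk> \<Longrightarrow>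
      \<P>(\<omega> in M. X (Suc m) \<omega> = t \<bar> X m \<omega> = s) = \<P>(\<omega> in M. X (Suc n) \<omega> = t \<bar> X n \<omega> = s)"

text \<open>The entry at \<open>(i, j)\<close> is the probability that \<open>X 1 = s j\<close> given \<open>X 0 = s i\<close>.
  Every initial state must have positive probability, for otherwise some row of the matrix would
  be undefined.\<close>

definition has_transition_matrix ::
  "'w measure \<Rightarrow> (nat \<Rightarrow> 'w \<Rightarrow> 's) \<Rightarrow> 'i set \<Rightarrow> ('i \<Rightarrow> 's) \<Rightarrow> ('i \<Rightarrow> 'i \<Rightarrow> real) \<Rightarrow> bool"
  where "has_transition_matrix M X \<Lambda> s p \<longleftrightarrow>
    (\<forall>i\<in>\<Lambda>. \<P>(\<omega> in M. X 0 \<omega> = s i) > 0 \<and>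
      (\<forall>j\<in>\<Lambda>. \<P>(\<omega> in M. X 1 \<omega> = s j \<bar> X 0 \<omega> = s i) = p i j))"

end

theory Submission
  imports Defs
begin

text \<open>The conditions on the structure constants say that each row of \<open>a\<close> is a probability
  distribution on the finite set of generators, so it suffices that every
  initial distribution and every stochastic matrix together come from a Markov chain. Injectivity of \<open>e\<close> turns a row indexed
  by \<open>\<Lambda>\<close> into a distribution on the states \<open>e ` \<Lambda>\<close>.

  The chain is the coordinate process on the space of paths. By the theorem of Ionescu Tulcea there
  is a probability measure on this space under which the first coordinate has a given distribution
  \<open>init\<close> and the next coordinate, given a path up to time \<open>n\<close>,
  has a distribution that may depend on that whole path; here it is \<open>K\<close> of the last state.
  Integrating this distribution over the part of an event \<open>Q\<close> of the past where the
  state at time \<open>n\<close> is \<open>s\<close> means integrating a constant, so that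
  \<open>P (Q, X n = s, X (n + 1) = t) = P (Q, X n = s) * K s t\<close> (\<open>prob_step\<close>).
  Taking for \<open>Q\<close> the event that fixes all earlier states, and then the sure event, shows that both
  conditional probabilities in the Markov property are \<open>K s t\<close>; as this does not
  involve \<open>n\<close>, the chain is homogeneous. The uniform initial distribution makes every
  row of the transition matrix observable at time \<open>0\<close>.\<close>

section \<open>Finite prefixes under the Ionescu Tulcea measure\<close>

lemma (in Ionescu_Tulcea) emeasure_lim_prefix:
  assumes "X \<in> sets (PiM {0..<n} M)"
  shows "emeasure PF.lim {\<omega> \<in> space PF.lim. restrict \<omega> {0..<n} \<in> X}
    = emeasure (C 0 n (\<lambda>_. undefined)) X"
proof -
  have "PF.emb {0..<n} {0..<n} X = X"
    using sets.sets_into_space[OF assms] by (simp add: prod_emb_id space_PiM)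
  moreover have "{\<omega> \<in> space PF.lim. restrict \<omega> {0..<n} \<in> X} = PF.emb UNIV {0..<n} X"
    by (auto simp: prod_emb_def PF.space_lim space_PiM)
  ultimately show ?thesis
    using assms emeasure_CI[OF order_refl assms] by (simp add: lim)
qed

lemma (in Ionescu_Tulcea) prob_space_lim: "prob_space PF.lim"
proof
  have "{\<omega> \<in> space PF.lim. restrict \<omega> {0..<0} \<in> space (PiM {0..<0} M)} = space PF.lim"
    by (auto simp: space_PiM)
  moreover have "(\<lambda>_. undefined) \<in> space (PiM {0..<0} M)"
    by (simp add: space_PiM)
  ultimately show "emeasure PF.lim (space PF.lim) = 1"
    using emeasure_lim_prefix[OF sets.top, of 0] by simp
qed

text \<open>The limit measure is characterised by its finite marginals \<open>C 0 n\<close>, and these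
  are built by composing kernels. Splitting off the last of these kernels
  gives the formula from which all transition probabilities are read off.\<close>

lemma (in Ionescu_Tulcea) emeasure_lim_prefix_Suc:
  assumes "X \<in> sets (PiM {0..<Suc n} M)"
  shows "emeasure PF.lim {\<omega> \<in> space PF.lim. restrict \<omega> {0..<Suc n} \<in> X}
    = (\<integral>\<^sup>+x. emeasure (P n x) {y \<in> space (M n). x(n := y) \<in> X} \<partial>C 0 n (\<lambda>_. undefined))"
proof -
  have empty: "(\<lambda>_. undefined) \<in> space (PiM {0..<0} M)"
    by (simp add: space_PiM)
  interpret C: prob_space "C 0 n (\<lambda>_. undefined)"
    by (rule prob_space_C[OF empty])
  have "emeasure PF.lim {\<omega> \<in> space PF.lim. restrict \<omega> {0..<Suc n} \<in> X}
      = (\<integral>\<^sup>+x. emeasure (eP n x) X \<partial>C 0 n (\<lambda>_. undefined))"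
    unfolding emeasure_lim_prefix[OF assms] C.simps add_0_left
    using measurable_eP[of n] assms sets_C[OF empty, of n]
    by (intro emeasure_bind[where N = "PiM {0..<Suc n} M"] C.not_empty)
       (simp_all cong: measurable_cong_sets)
  also have "\<dots> = (\<integral>\<^sup>+x. emeasure (P n x) {y \<in> space (M n). x(n := y) \<in> X} \<partial>C 0 n (\<lambda>_. undefined))"
    using assms space_C[OF empty, of n]
    by (intro nn_integral_cong) (simp add: emeasure_eP vimage_def Int_def conj_commute)
  finally show ?thesis .
qed

section \<open>The chain of an initial distribution and a transition kernel\<close>

locale markov_kernel =
  fixes S :: "'s set" and init :: "'s pmf" and K :: "'s \<Rightarrow> 's pmf"
  assumes countable_S: "countable S"
    and set_init: "set_pmf init \<subseteq> S"
    and set_K: "s \<in> S \<Longrightarrow> set_pmf (K s) \<subseteq> S"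
begin

text \<open>The argument \<open>x\<close> is the path so far, given at the times before \<open>n\<close>: the
  Ionescu Tulcea construction asks for kernels that may use all of it.\<close>

primrec next_state :: "nat \<Rightarrow> (nat \<Rightarrow> 's) \<Rightarrow> 's pmf" where
  "next_state 0 x = init"
| "next_state (Suc n) x = K (x n)"

text \<open>Restricting to \<open>S\<close> makes every path stay in \<open>S\<close> at all times,
  and not just almost surely, as measurability into \<^term>\<open>count_space S\<close> demands.\<close>

definition step :: "nat \<Rightarrow> (nat \<Rightarrow> 's) \<Rightarrow> 's measure" where
  "step n x = restrict_space (measure_pmf (next_state n x)) S"

lemma restrict_pmf_in_prob_algebra:
  assumes "set_pmf p \<subseteq> S"
  shows "restrict_space (measure_pmf p) S \<in> space (prob_algebra (count_space S))"
proof -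
  have "emeasure (measure_pmf p) S = 1"
    using assms by (simp add: measure_pmf.emeasure_eq_1_AE AE_measure_pmf_iff subset_iff)
  then have "prob_space (restrict_space (measure_pmf p) S)"
    by (intro prob_spaceI) (simp add: emeasure_restrict_space space_restrict_space)
  moreover have "sets (restrict_space (measure_pmf p) S) = sets (count_space S)"
    by (auto simp: sets_restrict_space)
  ultimately show ?thesis
    by (simp add: space_prob_algebra)
qed

lemma measurable_step: "step n \<in> measurable (PiM {0..<n} (\<lambda>_. count_space S)) (prob_algebra (count_space S))"
proof (cases n)
  case 0
  then show ?thesis
    by (simp add: step_def[abs_def] restrict_pmf_in_prob_algebra set_init)
next
  case (Suc m)
  have "(\<lambda>s. restrict_space (measure_pmf (K s)) S) \<in> measurable (count_space S) (prob_algebra (count_space S))"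
    by (simp add: restrict_pmf_in_prob_algebra set_K)
  then have "(\<lambda>x. restrict_space (measure_pmf (K (x m))) S)
      \<in> measurable (PiM {0..<Suc m} (\<lambda>_. count_space S)) (prob_algebra (count_space S))"
    by (rule measurable_compose[rotated]) (simp add: measurable_component_singleton)
  with Suc show ?thesis
    by (simp add: step_def[abs_def])
qed

sublocale IT: Ionescu_Tulcea step "\<lambda>_. count_space S"
proof (rule Ionescu_Tulcea.intro)
  show "step n \<in> measurable (PiM {0..<n} (\<lambda>_. count_space S)) (subprob_algebra (count_space S))" for n
    by (rule measurable_prob_algebraD[OF measurable_step])
  show "prob_space (step n x)" if "x \<in> space (PiM {0..<n} (\<lambda>_. count_space S))" for n x
    using measurable_space[OF measurable_step that] by (simp add: space_prob_algebra)
qed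

abbreviation path_measure :: "(nat \<Rightarrow> 's) measure" where
  "path_measure \<equiv> IT.PF.lim"

sublocale path: prob_space path_measure
  by (rule IT.prob_space_lim)

lemma measurable_coordinate: "(\<lambda>\<omega>. \<omega> n) \<in> measurable path_measure (count_space S)"
  unfolding measurable_cong_sets[OF IT.PF.sets_lim refl]
  by (rule measurable_component_singleton) simp

lemma emeasure_step_singleton: "t \<in> S \<Longrightarrow> emeasure (step n x) {t} = ennreal (pmf (next_state n x) t)"
  by (simp add: step_def emeasure_restrict_space emeasure_pmf_single)

lemma prob_initial:
  assumes "s \<in> S"
  shows "\<P>(\<omega> in path_measure. \<omega> 0 = s) = pmf init s"
proof -
  let ?X = "{x \<in> space (PiM {0..<Suc 0} (\<lambda>_. count_space S)). x 0 = s}"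
  have X: "?X \<in> sets (PiM {0..<Suc 0} (\<lambda>_. count_space S))"
    by measurable
  have "{\<omega> \<in> space path_measure. \<omega> 0 = s} = {\<omega> \<in> space path_measure. restrict \<omega> {0..<Suc 0} \<in> ?X}"
    by (auto simp: IT.PF.space_lim space_PiM PiE_iff)
  moreover have "{y \<in> S. (\<lambda>_. undefined)(0 := y) \<in> ?X} = {s}"
    using assms by (auto simp: space_PiM PiE_iff extensional_def)
  moreover have "(\<integral>\<^sup>+x. emeasure (step 0 x) {y \<in> S. x(0 := y) \<in> ?X} \<partial>IT.C 0 0 (\<lambda>_. undefined))
      = emeasure (step 0 (\<lambda>_. undefined)) {y \<in> S. (\<lambda>_. undefined)(0 := y) \<in> ?X}"
    unfolding IT.C.simps by (rule nn_integral_return) (simp_all add: PiM_empty)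
  ultimately have "emeasure path_measure {\<omega> \<in> space path_measure. \<omega> 0 = s} = ennreal (pmf init s)"
    using IT.emeasure_lim_prefix_Suc[OF X] assms
    by (simp only: space_count_space emeasure_step_singleton next_state.simps)
  then show ?thesis
    by (simp add: measure_def)
qed

text \<open>The event \<open>Q\<close> depends only on the first \<open>Suc n\<close> coordinates.
  On the paths in \<open>Q\<close> that are at \<open>s\<close> at time \<open>n\<close>, the probability of
  continuing with \<open>t\<close> is constantly \<open>pmf (K s) t\<close>, and off them the integrand
  vanishes.\<close>

lemma prob_step:
  assumes st: "s \<in> S" "t \<in> S"
    and Q[measurable]: "Measurable.pred (PiM {0..<Suc n} (\<lambda>_. count_space S)) Q"
    and prefix: "\<And>\<omega>. Q (restrict \<omega> {0..<Suc n}) \<longleftrightarrow> Q \<omega>"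
  shows "\<P>(\<omega> in path_measure. Q \<omega> \<and> \<omega> n = s \<and> \<omega> (Suc n) = t)
    = \<P>(\<omega> in path_measure. Q \<omega> \<and> \<omega> n = s) * pmf (K s) t"
proof -
  let ?N = "\<lambda>n::nat. PiM {0..<n} (\<lambda>_. count_space S)"
  let ?C = "IT.C 0 (Suc n) (\<lambda>_. undefined)"
  let ?A = "{x \<in> space (?N (Suc n)). Q x \<and> x n = s}"
  let ?X = "{x \<in> space (?N (Suc (Suc n))). Q (restrict x {0..<Suc n}) \<and> x n = s \<and> x (Suc n) = t}"
  have A: "?A \<in> sets (?N (Suc n))"
    by measurable
  have "(\<lambda>x. restrict x {0..<Suc n}) \<in> measurable (?N (Suc (Suc n))) (?N (Suc n))"
    by (rule measurable_restrict_subset) auto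
  note [measurable] = measurable_compose[OF this Q]
  have X: "?X \<in> sets (?N (Suc (Suc n)))"
    by measurable
  have A_path: "{\<omega> \<in> space path_measure. Q \<omega> \<and> \<omega> n = s}
      = {\<omega> \<in> space path_measure. restrict \<omega> {0..<Suc n} \<in> ?A}"
    by (auto simp: IT.PF.space_lim space_PiM PiE_iff prefix)
  have X_path: "{\<omega> \<in> space path_measure. Q \<omega> \<and> \<omega> n = s \<and> \<omega> (Suc n) = t}
      = {\<omega> \<in> space path_measure. restrict \<omega> {0..<Suc (Suc n)} \<in> ?X}"
    using prefix[of "restrict _ {0..<Suc (Suc n)}"]
    by (auto simp: IT.PF.space_lim space_PiM PiE_iff prefix)
  have fibre: "emeasure (step (Suc n) x) {y \<in> S. x(Suc n := y) \<in> ?X} = ennreal (pmf (K s) t) * indicator ?A x"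
    if "x \<in> space (?N (Suc n))" for x
  proof -
    have "Q (restrict (x(Suc n := t)) {0..<Suc n}) \<longleftrightarrow> Q x"
      using prefix[of x] by (simp add: restrict_fupd)
    then have "{y \<in> S. x(Suc n := y) \<in> ?X} = (if x \<in> ?A then {t} else {})"
      using that st by (auto simp: space_PiM PiE_iff extensional_def)
    then show ?thesis
      using st by (auto simp: emeasure_step_singleton)
  qed
  have empty: "(\<lambda>_. undefined) \<in> space (?N 0)"
    by (simp add: space_PiM)
  have "emeasure path_measure {\<omega> \<in> space path_measure. Q \<omega> \<and> \<omega> n = s \<and> \<omega> (Suc n) = t}
      = (\<integral>\<^sup>+x. ennreal (pmf (K s) t) * indicator ?A x \<partial>?C)"
    unfolding X_path IT.emeasure_lim_prefix_Suc[OF X] space_count_space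
    using fibre IT.space_C[OF empty, of "Suc n"] by (intro nn_integral_cong) simp
  also have "\<dots> = ennreal (pmf (K s) t) * emeasure ?C ?A"
    using A IT.sets_C[OF empty, of "Suc n"] by (intro nn_integral_cmult_indicator) (simp del: IT.C.simps)
  also have "emeasure ?C ?A = emeasure path_measure {\<omega> \<in> space path_measure. Q \<omega> \<and> \<omega> n = s}"
    unfolding A_path IT.emeasure_lim_prefix[OF A] ..
  finally show ?thesis
    by (simp add: path.emeasure_eq_measure ennreal_mult[symmetric] mult.commute)
qed

lemma cond_prob_step:
  assumes "s \<in> S" "t \<in> S"
    and "Measurable.pred (PiM {0..<Suc n} (\<lambda>_. count_space S)) Q"
    and "\<And>\<omega>. Q (restrict \<omega> {0..<Suc n}) \<longleftrightarrow> Q \<omega>"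
    and "\<P>(\<omega> in path_measure. Q \<omega> \<and> \<omega> n = s) > 0"
  shows "\<P>(\<omega> in path_measure. \<omega> (Suc n) = t \<bar> Q \<omega> \<and> \<omega> n = s) = pmf (K s) t"
  using assms(5) prob_step[OF assms(1-4)] by (simp add: cond_prob_def conj_ac)

lemma cond_prob_transition:
  assumes "s \<in> S" "t \<in> S" "\<P>(\<omega> in path_measure. \<omega> n = s) > 0"
  shows "\<P>(\<omega> in path_measure. \<omega> (Suc n) = t \<bar> \<omega> n = s) = pmf (K s) t"
  using cond_prob_step[where Q = "\<lambda>_. True"] assms by simp

text \<open>Both sides of the Markov property equal the same entry of \<open>K\<close>; the right-hand
  condition is non-null because it contains the left-hand one.\<close>

lemma homogeneous_markov_chain_coordinates:
  "homogeneous_markov_chain path_measure S (\<lambda>n \<omega>. \<omega> n)"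
proof unfold_locales
  show "countable S" by (rule countable_S)
  show "(\<lambda>\<omega>. \<omega> n) \<in> measurable path_measure (count_space S)" for n
    by (rule measurable_coordinate)
next
  fix n :: nat and s :: "nat \<Rightarrow> 's"
  assume "1 \<le> n" and s: "\<And>k. k \<le> n \<Longrightarrow> s k \<in> S"
    and pos: "\<P>(\<omega> in path_measure. \<forall>k<n. \<omega> k = s k) > 0"
  then obtain m where n: "n = Suc m"
    by (cases n) auto
  let ?Q = "\<lambda>\<omega>. \<forall>k<m. \<omega> k = s k"
  have past: "(\<forall>k<n. \<omega> k = s k) \<longleftrightarrow> ?Q \<omega> \<and> \<omega> m = s m" for \<omega>
    by (auto simp: n less_Suc_eq)
  have coordinate: "(\<lambda>\<omega>. \<omega> k) \<in> measurable (PiM {0..<Suc m} (\<lambda>_. count_space S)) (count_space S)"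
    if "k < m" for k
    using that by (intro measurable_component_singleton) auto
  have Q: "Measurable.pred (PiM {0..<Suc m} (\<lambda>_. count_space S)) ?Q"
    using coordinate by measurable
  have "\<P>(\<omega> in path_measure. \<omega> n = s n \<bar> \<forall>k<n. \<omega> k = s k) = pmf (K (s m)) (s n)"
    using pos s unfolding past by (subst n, intro cond_prob_step Q) (auto simp: n)
  moreover have "0 < \<P>(\<omega> in path_measure. \<omega> m = s m)"
  proof (rule less_le_trans[OF pos], rule path.finite_measure_mono)
    show "{\<omega> \<in> space path_measure. \<omega> m = s m} \<in> path.events"
      using measurable_coordinate by measurable
  qed (auto simp: n)
  then have "\<P>(\<omega> in path_measure. \<omega> n = s n \<bar> \<omega> (n - 1) = s (n - 1)) = pmf (K (s m)) (s n)"
    using s by (simp add: n cond_prob_transition)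
  ultimately show "\<P>(\<omega> in path_measure. \<omega> n = s n \<bar> \<forall>k<n. \<omega> k = s k)
      = \<P>(\<omega> in path_measure. \<omega> n = s n \<bar> \<omega> (n - 1) = s (n - 1))"
    by simp
qed (simp add: cond_prob_transition)

end

section \<open>Evolution algebras with stochastic structure constants\<close>

text \<open>Injectivity matters: otherwise the weights of indices with a common image would add up.\<close>

lemma ex_pmf_of_weights:
  fixes w :: "'i \<Rightarrow> real"
  assumes "finite \<Lambda>" "inj_on e \<Lambda>" "\<And>k. k \<in> \<Lambda> \<Longrightarrow> 0 \<le> w k" "(\<Sum>k\<in>\<Lambda>. w k) = 1"
  shows "\<exists>p. set_pmf p \<subseteq> e ` \<Lambda> \<and> (\<forall>k\<in>\<Lambda>. pmf p (e k) = w k)"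
proof -
  let ?f = "\<lambda>v. if v \<in> e ` \<Lambda> then w (inv_into \<Lambda> e v) else 0"
  have nonneg: "0 \<le> ?f v" for v
    using assms by (simp add: inv_into_into)
  have "(\<integral>\<^sup>+v. ennreal (?f v) \<partial>count_space UNIV) = (\<Sum>v\<in>e ` \<Lambda>. ennreal (?f v))"
    using assms by (intro nn_integral_count_space'[where A = "e ` \<Lambda>"]) auto
  also have "\<dots> = (\<Sum>k\<in>\<Lambda>. ennreal (w k))"
    using assms by (simp add: sum.reindex)
  also have "\<dots> = 1"
    using assms by (simp add: sum_ennreal)
  finally have total: "(\<integral>\<^sup>+v. ennreal (?f v) \<partial>count_space UNIV) = 1" .
  have "pmf (embed_pmf ?f) v = ?f v" for v
    by (rule pmf_embed_pmf[OF nonneg total])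
  moreover have "set_pmf (embed_pmf ?f) \<subseteq> e ` \<Lambda>"
    unfolding set_embed_pmf[OF nonneg total] by auto
  ultimately show ?thesis
    using assms by (intro exI[of _ "embed_pmf ?f"]) simp
qed

theorem theorem2p3:
  fixes scale :: "real \<Rightarrow> 'v::ab_group_add \<Rightarrow> 'v"
    and mult :: "'v \<Rightarrow> 'v \<Rightarrow> 'v"
    and \<Lambda> :: "'i set"
    and e :: "'i \<Rightarrow> 'v"
    and a :: "'i \<Rightarrow> 'i \<Rightarrow> real"
  assumes "evolution_algebra scale mult \<Lambda> e a"
    and "\<And>i k. \<lbrakk>i \<in> \<Lambda>; k \<in> \<Lambda>\<rbrakk> \<Longrightarrow> 0 \<le> a i k \<and> a i k \<le> 1"
    and "\<And>i. i \<in> \<Lambda> \<Longrightarrow> (\<Sum>k\<in>\<Lambda>. a i k) = 1"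
  shows "\<exists>(M :: (nat \<Rightarrow> 'v) measure) (X :: nat \<Rightarrow> (nat \<Rightarrow> 'v) \<Rightarrow> 'v).
    homogeneous_markov_chain M (e ` \<Lambda>) X \<and> has_transition_matrix M X \<Lambda> e a"
proof -
  have fin: "finite \<Lambda>" and ne: "\<Lambda> \<noteq> {}" and inj: "inj_on e \<Lambda>"
    using assms(1) by (simp_all add: evolution_algebra.finite_index
        evolution_algebra.nonempty_index evolution_algebra.inj_generators)
  have "\<forall>i\<in>\<Lambda>. \<exists>p. set_pmf p \<subseteq> e ` \<Lambda> \<and> (\<forall>k\<in>\<Lambda>. pmf p (e k) = a i k)"
    using fin inj assms(2,3) by (intro ballI ex_pmf_of_weights) auto
  then obtain row where row: "\<And>i. i \<in> \<Lambda> \<Longrightarrow> set_pmf (row i) \<subseteq> e ` \<Lambda>"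
      "\<And>i k. i \<in> \<Lambda> \<Longrightarrow> k \<in> \<Lambda> \<Longrightarrow> pmf (row i) (e k) = a i k"
    by metis
  define K where "K v = row (inv_into \<Lambda> e v)" for v
  have K: "K (e i) = row i" if "i \<in> \<Lambda>" for i
    using that inj by (simp add: K_def)
  interpret markov_kernel "e ` \<Lambda>" "pmf_of_set (e ` \<Lambda>)" K
    proof unfold_locales
    show "set_pmf (K v) \<subseteq> e ` \<Lambda>" if "v \<in> e ` \<Lambda>" for v
      using that row(1) K by fastforce
  qed (use fin ne in \<open>simp_all add: countable_finite\<close>)
  have initial_pos: "\<P>(\<omega> in path_measure. \<omega> 0 = e i) > 0" if "i \<in> \<Lambda>" for i
    using that fin ne by (subst prob_initial) (auto simp: card_gt_0_iff)
  then have "has_transition_matrix path_measure (\<lambda>n \<omega>. \<omega> n) \<Lambda> e a"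
    using cond_prob_transition[where n = 0] by (simp add: has_transition_matrix_def K row(2))
  with homogeneous_markov_chain_coordinates show ?thesis
    by blast
qed

end
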